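(* Let $G$ be a group generated by a finite symmetric set $S\subset G$. Then the cancelation norm on $G$ is equal to the biinvariant word norm associated with $S$, i.e. $|g|_\times=\|g\|$ for every $g\in G$.
   Context: Let $\overline S$ be the set of all conjugates in $G$ of elements of $S$. The biinvariant word norm is $\|g\|=\min\{k\ge0 : g=s_1\cdots s_k,\ s_i\in\overline S\}$. For a word $w=s_1\cdots s_n$ in the alphabet $S$, the cancelation length $|w|_\times$ is the least $k\ge 0$ such that deleting some $k$ of the letters $s_1,\dots,s_n$ yields a word representing the identity of $G$. The cancelation norm is $|g|_\times=\min\{|w|_\times : w\text{ a word in } S\text{ representing } g\}$. *)

theory Defs
  imports "HOL-Algebra.Generated_Groups"
begin

text \<open>
  The minima below are taken with \<^const>\<open>Least\<close> over sets of natural numbers. The set for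
  the cancelation length is nonempty because all letters of a word may be deleted; the other two
  are nonempty for every group element when the symmetric set \<open>S\<close> generates \<open>G\<close>.
\<close>

definition conjugates :: "('a, 'b) monoid_scheme \<Rightarrow> 'a set \<Rightarrow> 'a set" where
  "conjugates G S =
     {h \<otimes>\<^bsub>G\<^esub> s \<otimes>\<^bsub>G\<^esub> inv\<^bsub>G\<^esub> h | h s. h \<in> carrier G \<and> s \<in> S}"

definition word_value :: "('a, 'b) monoid_scheme \<Rightarrow> 'a list \<Rightarrow> 'a" where
  "word_value G w = foldr (mult G) w \<one>\<^bsub>G\<^esub>"

definition biinvariant_word_norm :: "('a, 'b) monoid_scheme \<Rightarrow> 'a set \<Rightarrow> 'a \<Rightarrow> nat" where
  "biinvariant_word_norm G S g =
     (LEAST k. \<exists>w \<in> lists (conjugates G S). length w = k \<and> word_value G w = g)"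

text \<open>
  \<open>D\<close> is the set of positions of the deleted letters, so different occurrences of the same
  letter are deleted independently.
\<close>

definition cancelation_length :: "('a, 'b) monoid_scheme \<Rightarrow> 'a list \<Rightarrow> nat" where
  "cancelation_length G w =
     (LEAST k. \<exists>D \<subseteq> {..<length w}. card D = k \<and> word_value G (nths w (- D)) = \<one>\<^bsub>G\<^esub>)"

definition cancelation_norm :: "('a, 'b) monoid_scheme \<Rightarrow> 'a set \<Rightarrow> 'a \<Rightarrow> nat" where
  "cancelation_norm G S g =
     (LEAST k. \<exists>w \<in> lists S. word_value G w = g \<and> cancelation_length G w = k)"

end

theory Submission
  imports Defs "HOL-Library.Sublist"
begin

text \<open>
  A deleted letter of a word and a conjugate factor of its value are two views of the same thing.

  Suppose that deleting \<open>k\<close> letters of \<open>w\<close> leaves \<open>r\<close>. Moving a deleted letter \<open>s\<close> to the left past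
  the kept letters that precede it, of product \<open>h\<close>, replaces it by \<open>h s h\<inverse>\<close>, because
  \<open>h s = (h s h\<inverse>) h\<close>. Hence the value of \<open>w\<close> is a product of \<open>k\<close> conjugates of letters times the
  value of \<open>r\<close>, and when \<open>r\<close> represents the identity only the conjugates remain
  (\<open>word_value_eq_conjugates_times_subseq\<close>).

  Conversely, since \<open>S\<close> generates \<open>G\<close> and is symmetric, a conjugate \<open>h s h\<inverse>\<close> is spelled by a word
  \<open>u s u'\<close> in which \<open>u\<close> represents \<open>h\<close> and \<open>u'\<close> represents \<open>h\<inverse>\<close>; deleting \<open>s\<close> leaves \<open>u u'\<close>, which
  represents the identity. Concatenating \<open>k\<close> such words gives a word for the product of \<open>k\<close>
  conjugates that \<open>k\<close> deletions trivialise (\<open>conjugate_product_as_word\<close>).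
\<close>

section \<open>Deletions as subsequences\<close>

text \<open>
  Subsequences lend themselves to structural induction and to concatenation, which sets of deleted
  positions do not; the number of deletions is then a difference of lengths.
\<close>

lemma deletion_iff_subseq:
  "(\<exists>D \<subseteq> {..<length w}. card D = k \<and> nths w (- D) = r) \<longleftrightarrow>
   subseq r w \<and> length w = k + length r"
proof
  assume "\<exists>D \<subseteq> {..<length w}. card D = k \<and> nths w (- D) = r"
  then obtain D where D: "D \<subseteq> {..<length w}" "card D = k" "nths w (- D) = r"
    by blast
  have "length r = card ({..<length w} - D)"
    using D(3) by (auto simp: length_nths intro!: arg_cong[where f = card])
  also have "\<dots> = length w - k"
    using D by (simp add: card_Diff_subset finite_subset)
  finally have "length r = length w - k" .
  moreover have "k \<le> length w"
    using D card_mono[of "{..<length w}" D] by simp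
  ultimately show "subseq r w \<and> length w = k + length r"
    using D(3) subseq_conv_nths by auto
next
  assume r: "subseq r w \<and> length w = k + length r"
  then obtain N where N: "r = nths w N"
    by (auto simp: subseq_conv_nths)
  \<comment> \<open>\<open>N\<close> may contain numbers that are not positions in \<open>w\<close>, so only its part below \<open>length w\<close> counts.\<close>
  let ?D = "{..<length w} - N"
  have "nths w (- ?D) = nths w N"
    unfolding nths_def by (intro arg_cong[where f = "map fst"] filter_cong)
      (auto dest: set_zip_rightD)
  moreover have "card ?D = length w - card ({..<length w} \<inter> N)"
    by (simp add: card_Diff_subset_Int)
  moreover have "length r = card ({..<length w} \<inter> N)"
    unfolding N length_nths by (rule arg_cong[where f = card]) auto
  ultimately show "\<exists>D \<subseteq> {..<length w}. card D = k \<and> nths w (- D) = r"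
    using r N by (intro exI[of _ ?D]) auto
qed

lemma subseq_set_subset: "subseq r w \<Longrightarrow> set r \<subseteq> set w"
  by (auto simp: subseq_conv_nths dest: in_set_nthsD)

lemma cancelation_length_eq_Least_subseq:
  "cancelation_length G w =
     (LEAST k. \<exists>r. subseq r w \<and> length w = k + length r \<and> word_value G r = \<one>\<^bsub>G\<^esub>)"
proof -
  have "(\<exists>D \<subseteq> {..<length w}. card D = k \<and> word_value G (nths w (- D)) = \<one>\<^bsub>G\<^esub>) \<longleftrightarrow>
        (\<exists>r. (\<exists>D \<subseteq> {..<length w}. card D = k \<and> nths w (- D) = r) \<and> word_value G r = \<one>\<^bsub>G\<^esub>)"
    for k
    by blast
  then show ?thesis
    unfolding cancelation_length_def deletion_iff_subseq by (simp add: conj_assoc)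
qed

lemma cancelation_length_attained:
  obtains r where "subseq r w" "length w = cancelation_length G w + length r"
    "word_value G r = \<one>\<^bsub>G\<^esub>"
proof -
  \<comment> \<open>Deleting every letter leaves the empty word, so the minimum is over a nonempty set.\<close>
  have "\<exists>r. subseq r w \<and> length w = length w + length r \<and> word_value G r = \<one>\<^bsub>G\<^esub>"
    by (intro exI[of _ "[]"]) (simp add: word_value_def)
  then have "\<exists>r. subseq r w \<and> length w = cancelation_length G w + length r \<and>
      word_value G r = \<one>\<^bsub>G\<^esub>"
    unfolding cancelation_length_eq_Least_subseq by (rule LeastI)
  then show thesis
    using that by (elim exE conjE)
qed

section \<open>Values of words and conjugation\<close>

context group
begin

lemma word_value_Nil [simp]: "word_value G [] = \<one>"
  by (simp add: word_value_def)

lemma word_value_Cons [simp]: "word_value G (x # w) = x \<otimes> word_value G w"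
  by (simp add: word_value_def)

lemma word_value_closed [simp]: "set w \<subseteq> carrier G \<Longrightarrow> word_value G w \<in> carrier G"
  by (induction w) auto

lemma word_value_append [simp]:
  "set u \<subseteq> carrier G \<Longrightarrow> set v \<subseteq> carrier G \<Longrightarrow>
   word_value G (u @ v) = word_value G u \<otimes> word_value G v"
  by (induction u) (auto simp: m_assoc)

lemma conjugates_subset_carrier: "S \<subseteq> carrier G \<Longrightarrow> conjugates G S \<subseteq> carrier G"
  by (auto simp: conjugates_def)

lemma subset_conjugates:
  assumes "S \<subseteq> carrier G"
  shows "S \<subseteq> conjugates G S"
proof
  fix s assume "s \<in> S"
  then have "s = \<one> \<otimes> s \<otimes> inv \<one>" using assms by auto
  with \<open>s \<in> S\<close> show "s \<in> conjugates G S" unfolding conjugates_def by blast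
qed

lemma conjugates_closed_conjugation:
  assumes "S \<subseteq> carrier G" "a \<in> carrier G" "c \<in> conjugates G S"
  shows "a \<otimes> c \<otimes> inv a \<in> conjugates G S"
proof -
  obtain h s where hs: "c = h \<otimes> s \<otimes> inv h" "h \<in> carrier G" "s \<in> S"
    using assms(3) by (auto simp: conjugates_def)
  then have "a \<otimes> c \<otimes> inv a = (a \<otimes> h) \<otimes> s \<otimes> inv (a \<otimes> h)"
    using assms by (auto simp: m_assoc inv_mult_group)
  then show ?thesis using hs assms(2) unfolding conjugates_def by blast
qed

lemma inv_mult_cancel_left:
  "a \<in> carrier G \<Longrightarrow> x \<in> carrier G \<Longrightarrow> inv a \<otimes> (a \<otimes> x) = x"
  by (simp flip: m_assoc)

lemma word_value_map_conjugation:
  assumes "a \<in> carrier G" "set v \<subseteq> carrier G"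
  shows "word_value G (map (\<lambda>c. a \<otimes> c \<otimes> inv a) v) = a \<otimes> word_value G v \<otimes> inv a"
  using assms(2)
proof (induction v)
  case Nil
  then show ?case using assms(1) by simp
next
  case (Cons c v)
  then show ?case using assms(1) by (simp add: m_assoc inv_mult_cancel_left)
qed

end

section \<open>From deletions to conjugates and back\<close>

context group
begin

text \<open>
  A deleted letter at the front is itself a conjugate factor. A kept letter \<open>a\<close> at the front is
  carried past the conjugate factors of the rest of the word, which conjugates each of them by
  \<open>a\<close> and leaves their number unchanged.
\<close>

lemma word_value_eq_conjugates_times_subseq:
  assumes "subseq r w" "S \<subseteq> carrier G" "set w \<subseteq> S"
  shows "\<exists>v \<in> lists (conjugates G S).
           length w = length v + length r \<and> word_value G w = word_value G v \<otimes> word_value G r"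
  using assms(1,3)
proof (induction rule: list_emb.induct)
  case (list_emb_Nil w)
  then show ?case
    using assms(2) subset_conjugates[OF assms(2)]
    by (intro bexI[of _ w]) auto
next
  case (list_emb_Cons r w a)
  then obtain v where v: "v \<in> lists (conjugates G S)" "length w = length v + length r"
    "word_value G w = word_value G v \<otimes> word_value G r"
    by auto
  have "set v \<subseteq> carrier G" "set r \<subseteq> carrier G" "a \<in> carrier G" "a \<in> conjugates G S"
    using v(1) list_emb_Cons.prems subseq_set_subset[OF list_emb_Cons.hyps] assms(2)
      conjugates_subset_carrier[OF assms(2)] subset_conjugates[OF assms(2)]
    by auto
  then show ?case
    using v by (intro bexI[of _ "a # v"]) (auto simp: m_assoc)
next
  case (list_emb_Cons2 b a r w)
  then obtain v where v: "v \<in> lists (conjugates G S)" "length w = length v + length r"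
    "word_value G w = word_value G v \<otimes> word_value G r"
    by auto
  have carr: "set v \<subseteq> carrier G" "set r \<subseteq> carrier G" "a \<in> carrier G"
    using v(1) list_emb_Cons2.prems subseq_set_subset[OF list_emb_Cons2.hyps(2)] assms(2)
      conjugates_subset_carrier[OF assms(2)]
    by auto
  let ?v = "map (\<lambda>c. a \<otimes> c \<otimes> inv a) v"
  have "word_value G (a # w) = word_value G ?v \<otimes> word_value G (a # r)"
    using v(3) carr by (simp add: word_value_map_conjugation m_assoc inv_mult_cancel_left)
  moreover have "?v \<in> lists (conjugates G S)"
    using v(1) conjugates_closed_conjugation[OF assms(2) carr(3)] by auto
  ultimately show ?case
    using v(2) list_emb_Cons2.hyps(1) by (intro bexI[of _ ?v]) auto
qed

lemma generate_imp_word: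
  assumes "g \<in> generate G S" "S \<subseteq> carrier G" "\<forall>s\<in>S. inv s \<in> S"
  shows "\<exists>w \<in> lists S. word_value G w = g"
  using assms(1)
proof (induction rule: generate.induct)
  case one
  then show ?case by (intro bexI[of _ "[]"]) auto
next
  case (incl h)
  then show ?case using assms(2) by (intro bexI[of _ "[h]"]) auto
next
  case (inv h)
  then show ?case using assms(2,3) by (intro bexI[of _ "[inv h]"]) auto
next
  case (eng g h)
  then obtain u v where "u \<in> lists S" "v \<in> lists S" "word_value G u = g" "word_value G v = h"
    by blast
  moreover from this have "set u \<subseteq> carrier G" "set v \<subseteq> carrier G"
    using assms(2) by auto
  ultimately show ?case by (intro bexI[of _ "u @ v"]) auto
qed

text \<open>
  Each conjugate \<open>h s h\<inverse>\<close> contributes a block \<open>u s u'\<close> with exactly one deletion, that of the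
  middle \<open>s\<close>. Here \<open>u'\<close> is any word with value \<open>h\<inverse>\<close>: cancelation in \<open>u u'\<close> is required of its
  value, not letter by letter.
\<close>

lemma conjugate_product_as_word:
  assumes "S \<subseteq> carrier G" "\<forall>s\<in>S. inv s \<in> S" "generate G S = carrier G"
    and "v \<in> lists (conjugates G S)"
  shows "\<exists>w \<in> lists S. \<exists>r. subseq r w \<and> length w = length v + length r \<and>
           word_value G w = word_value G v \<and> word_value G r = \<one>"
  using assms(4)
proof (induction v)
  case Nil
  then show ?case by (intro bexI[of _ "[]"]) auto
next
  case (Cons c v)
  then obtain w r where w: "w \<in> lists S" "subseq r w" "length w = length v + length r"
    "word_value G w = word_value G v" "word_value G r = \<one>"
    by auto
  obtain h s where c: "c = h \<otimes> s \<otimes> inv h" "h \<in> carrier G" "s \<in> S"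
    using Cons.hyps(1) by (auto simp: conjugates_def)
  obtain u u' where u: "u \<in> lists S" "word_value G u = h" "u' \<in> lists S" "word_value G u' = inv h"
    using generate_imp_word[of _ S] assms(1-3) c(2) by (metis inv_closed)
  have carr: "s \<in> carrier G" "set u \<subseteq> carrier G" "set u' \<subseteq> carrier G" "set w \<subseteq> carrier G"
    "set r \<subseteq> carrier G"
    using assms(1) c(3) u w(1) subseq_set_subset[OF w(2)] by auto
  let ?w = "u @ s # u' @ w" and ?r = "u @ u' @ r"
  have "subseq ?r ?w"
    using w(2) by (intro list_emb_append_mono list_emb_Cons) auto
  moreover have "word_value G ?w = word_value G (c # v)"
    using carr c u w(4) word_value_closed[OF carr(4)] by (simp add: m_assoc)
  moreover have "word_value G ?r = \<one>"
    using carr c u w(5) by simp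
  ultimately show ?case
    using u(1,3) w(1,3) c(3) by (intro bexI[of _ ?w] exI[of _ ?r]) auto
qed

end

section \<open>Comparison of the two norms\<close>

context group
begin

lemma biinvariant_word_norm_le_cancelation_length:
  assumes "S \<subseteq> carrier G" "w \<in> lists S"
  shows "biinvariant_word_norm G S (word_value G w) \<le> cancelation_length G w"
proof -
  obtain r where r: "subseq r w" "length w = cancelation_length G w + length r"
    "word_value G r = \<one>"
    by (rule cancelation_length_attained)
  then obtain v where v: "v \<in> lists (conjugates G S)" "length w = length v + length r"
    "word_value G w = word_value G v \<otimes> word_value G r"
    using word_value_eq_conjugates_times_subseq[of r w S] assms by auto
  have "set v \<subseteq> carrier G"
    using v(1) conjugates_subset_carrier[OF assms(1)] by auto
  then have "word_value G v = word_value G w"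
    using v(3) r(3) by simp
  moreover have "length v = cancelation_length G w"
    using v(2) r(2) by simp
  ultimately show ?thesis
    unfolding biinvariant_word_norm_def using v(1) by (blast intro: Least_le)
qed

lemma cancelation_norm_le_length:
  assumes "S \<subseteq> carrier G" "\<forall>s\<in>S. inv s \<in> S" "generate G S = carrier G"
    and "v \<in> lists (conjugates G S)"
  shows "cancelation_norm G S (word_value G v) \<le> length v"
proof -
  obtain w r where w: "w \<in> lists S" "subseq r w" "length w = length v + length r"
    "word_value G w = word_value G v" "word_value G r = \<one>"
    using conjugate_product_as_word[OF assms] by blast
  have "cancelation_norm G S (word_value G v) \<le> cancelation_length G w"
    unfolding cancelation_norm_def using w(1,4) by (blast intro: Least_le)
  also have "\<dots> \<le> length v"
    unfolding cancelation_length_eq_Least_subseq using w by (blast intro: Least_le)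
  finally show ?thesis .
qed

end

theorem proposition2p1:
  fixes G :: "('a, 'b) monoid_scheme" and S :: "'a set"
  assumes "group G"
    and "finite S"
    and "S \<subseteq> carrier G"
    and "\<forall>s\<in>S. inv\<^bsub>G\<^esub> s \<in> S"
    and "generate G S = carrier G"
  shows "\<forall>g\<in>carrier G. cancelation_norm G S g = biinvariant_word_norm G S g"
proof
  interpret group G by fact
  fix g assume "g \<in> carrier G"
  then obtain w0 where w0: "w0 \<in> lists S" "word_value G w0 = g"
    using generate_imp_word[of g S] assms(3-5) by auto
  have "\<exists>w \<in> lists S. word_value G w = g \<and> cancelation_length G w = cancelation_norm G S g"
    unfolding cancelation_norm_def
    by (rule LeastI[where k = "cancelation_length G w0"]) (use w0 in blast)
  then have ge: "biinvariant_word_norm G S g \<le> cancelation_norm G S g"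
    using biinvariant_word_norm_le_cancelation_length[OF assms(3)] by metis
  \<comment> \<open>A letter is a conjugate of itself, so a word in \<open>S\<close> also witnesses that the biinvariant word
    norm is a minimum over a nonempty set.\<close>
  have "w0 \<in> lists (conjugates G S)"
    using w0(1) subset_conjugates[OF assms(3)] by auto
  have "\<exists>v \<in> lists (conjugates G S).
      length v = biinvariant_word_norm G S g \<and> word_value G v = g"
    unfolding biinvariant_word_norm_def
    by (rule LeastI[where k = "length w0"]) (use w0(2) \<open>w0 \<in> lists (conjugates G S)\<close> in blast)
  then have "cancelation_norm G S g \<le> biinvariant_word_norm G S g"
    using cancelation_norm_le_length[OF assms(3-5)] by metis
  with ge show "cancelation_norm G S g = biinvariant_word_norm G S g"
    by simp
qed

end
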